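(* Let $f:[0,\infty)\to\mathbb R$. The following are equivalent: 1. For every $n\ge1$, the entrywise map induced by $f$ is Loewner convex on arbitrary pairs in $\mathcal C_{\min,n}$. 2. For every $n\ge1$, the entrywise map induced by $f$ is Loewner concave on arbitrary pairs in $\mathcal C_{\min,n}$. 3. The function $f$ is affine on $[0,\infty)$. The same equivalence holds with $\mathcal C_{\min,n}$ replaced by $\mathcal C_{\max,n}$ throughout. Moreover, in assertions 1 and 2 (in both the Min and the Max case) it is sufficient to require the property only for $n=2$.
   Context: For $x=(x_1,\ldots,x_n)\in\mathbb R^n$, define the $n\times n$ real symmetric matrices $A_{\min}(x)=\bigl(x_{\min(i,j)}\bigr)_{i,j=1}^n$ and $A_{\max}(x)=\bigl(x_{\max(i,j)}\bigr)_{i,j=1}^n$. Set $\mathcal C_{\min,n}=\{A_{\min}(x):0\le x_1\le x_2\le\cdots\le x_n\}$ and $\mathcal C_{\max,n}=\{A_{\max}(x):x_1\ge x_2\ge\cdots\ge x_n\ge0\}$; both are convex cones. For a matrix $A=(a_{ij})$ with entries in $[0,\infty)$, $f[A]=(f(a_{ij}))$; the entrywise map induced by $f$ is $A\mapsto f[A]$. For real symmetric matrices, $A\preceq B$ means that $B-A$ is positive semidefinite. The entrywise map induced by $f$ is Loewner convex on arbitrary pairs in a cone $\mathcal C$ (where $\mathcal C=\mathcal C_{\min,n}$ or $\mathcal C_{\max,n}$) if $f[\lambda A+(1-\lambda)B]\preceq\lambda f[A]+(1-\lambda)f[B]$ for all $A,B\in\mathcal C$ and all $0\le\lambda\le1$.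 It is Loewner concave on arbitrary pairs in $\mathcal C$ if the reverse inequality $\lambda f[A]+(1-\lambda)f[B]\preceq f[\lambda A+(1-\lambda)B]$ holds for all such $A,B,\lambda$. *)

theory Defs
  imports Complex_Main "Jordan_Normal_Form.Matrix"
begin

(* Vectors are indexed by 0, ..., n - 1, so the coordinate x_i of the mathematical text
   is x $ (i - 1); the shift commutes with min and max. *)

definition A_min :: "real vec \<Rightarrow> real mat" where
  "A_min x = mat (dim_vec x) (dim_vec x) (\<lambda>(i, j). x $ min i j)"

definition A_max :: "real vec \<Rightarrow> real mat" where
  "A_max x = mat (dim_vec x) (dim_vec x) (\<lambda>(i, j). x $ max i j)"

definition C_min :: "nat \<Rightarrow> real mat set" where
  "C_min n = {A_min x | x. x \<in> carrier_vec n \<and> (\<forall>i<n. 0 \<le> x $ i) \<and>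
     (\<forall>i j. i \<le> j \<and> j < n \<longrightarrow> x $ i \<le> x $ j)}"

definition C_max :: "nat \<Rightarrow> real mat set" where
  "C_max n = {A_max x | x. x \<in> carrier_vec n \<and> (\<forall>i<n. 0 \<le> x $ i) \<and>
     (\<forall>i j. i \<le> j \<and> j < n \<longrightarrow> x $ i \<ge> x $ j)}"

(* The equation transpose_mat A = A also forces A to be square. *)
definition pos_semidef :: "real mat \<Rightarrow> bool" where
  "pos_semidef A \<longleftrightarrow> transpose_mat A = A \<and>
     (\<forall>v \<in> carrier_vec (dim_row A). 0 \<le> v \<bullet> (A *\<^sub>v v))"

(* Meaningful for symmetric matrices of equal dimension, the only case in which it is used. *)
definition loewner_le :: "real mat \<Rightarrow> real mat \<Rightarrow> bool" (infix \<open>\<preceq>\<^sub>L\<close> 50) where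
  "A \<preceq>\<^sub>L B \<longleftrightarrow> pos_semidef (B - A)"

(* The entrywise map f[A] is map_mat f A. A function f on [0, \<infinity>) is represented by a total
   function; on cones of entrywise nonnegative matrices its values at negative
   arguments are never used. *)

definition loewner_convex_on :: "real mat set \<Rightarrow> (real \<Rightarrow> real) \<Rightarrow> bool" where
  "loewner_convex_on C f \<longleftrightarrow> (\<forall>A\<in>C. \<forall>B\<in>C. \<forall>t. 0 \<le> t \<and> t \<le> 1 \<longrightarrow>
     map_mat f (t \<cdot>\<^sub>m A + (1 - t) \<cdot>\<^sub>m B) \<preceq>\<^sub>L t \<cdot>\<^sub>m map_mat f A + (1 - t) \<cdot>\<^sub>m map_mat f B)"

definition loewner_concave_on :: "real mat set \<Rightarrow> (real \<Rightarrow> real) \<Rightarrow> bool" where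
  "loewner_concave_on C f \<longleftrightarrow> (\<forall>A\<in>C. \<forall>B\<in>C. \<forall>t. 0 \<le> t \<and> t \<le> 1 \<longrightarrow>
     t \<cdot>\<^sub>m map_mat f A + (1 - t) \<cdot>\<^sub>m map_mat f B \<preceq>\<^sub>L map_mat f (t \<cdot>\<^sub>m A + (1 - t) \<cdot>\<^sub>m B))"

definition affine_fun_on :: "real set \<Rightarrow> (real \<Rightarrow> real) \<Rightarrow> bool" where
  "affine_fun_on S f \<longleftrightarrow> (\<exists>a b. \<forall>x\<in>S. f x = a * x + b)"

end

theory Submission
  imports Defs
begin

text \<open>
  Everything is governed by the Jensen gap \<open>t * f a + (1 - t) * f b - f (t * a + (1 - t) * b)\<close>.
  Since \<open>f\<close> acts entrywise, Loewner convexity says exactly that the matrix of the Jensen gaps of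
  corresponding entries of \<open>A\<close> and \<open>B\<close> is positive semidefinite, and Loewner concavity of \<open>f\<close> is
  Loewner convexity of \<open>- f\<close>. If \<open>f\<close> is affine, all gaps vanish and both properties hold in
  every size.

  Conversely, size 2 already forces affinity. In the Min case take \<open>A\<close> and \<open>B\<close> to be the matrices
  of \<open>(0, b)\<close> and \<open>(b, b)\<close>. Their second parameters agree, so with \<open>g\<close> the gap of \<open>0\<close>
  and \<open>b\<close> the gap matrix has rows \<open>(g, g)\<close> and \<open>(g, 0)\<close>. Its quadratic form is \<open>g\<close>
  at \<open>(1, 0)\<close> and \<open>- g\<close> at \<open>(1, -1)\<close>; hence \<open>g = 0\<close>. So \<open>f\<close> is affine on every segment
  \<open>[0, b]\<close>, and therefore on the half-line. In the Max case the parameters are reversed,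
  which just exchanges the two indices
  (\<open>affine_of_loewner_convex\<close>).
\<close>

definition jensen_gap :: "(real \<Rightarrow> real) \<Rightarrow> real \<Rightarrow> real \<Rightarrow> real \<Rightarrow> real" where
  "jensen_gap f t a b = t * f a + (1 - t) * f b - f (t * a + (1 - t) * b)"

lemma loewner_convex_on_iff_gap:
  assumes "C \<subseteq> carrier_mat n n"
  shows "loewner_convex_on C f \<longleftrightarrow> (\<forall>A\<in>C. \<forall>B\<in>C. \<forall>t. 0 \<le> t \<and> t \<le> 1 \<longrightarrow>
    pos_semidef (mat n n (\<lambda>(i, j). jensen_gap f t (A $$ (i, j)) (B $$ (i, j)))))"
proof -
  have "t \<cdot>\<^sub>m map_mat f A + (1 - t) \<cdot>\<^sub>m map_mat f B - map_mat f (t \<cdot>\<^sub>m A + (1 - t) \<cdot>\<^sub>m B)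
      = mat n n (\<lambda>(i, j). jensen_gap f t (A $$ (i, j)) (B $$ (i, j)))"
    if "A \<in> C" "B \<in> C" for A B t
  proof -
    have "A \<in> carrier_mat n n" "B \<in> carrier_mat n n"
      using that assms by auto
    then show ?thesis
      by (intro eq_matI) (auto simp: jensen_gap_def)
  qed
  then show ?thesis
    unfolding loewner_convex_on_def loewner_le_def by simp
qed

lemma loewner_concave_on_iff_convex_uminus:
  assumes "C \<subseteq> carrier_mat n n"
  shows "loewner_concave_on C f \<longleftrightarrow> loewner_convex_on C (\<lambda>x. - f x)"
proof -
  have "map_mat f (t \<cdot>\<^sub>m A + (1 - t) \<cdot>\<^sub>m B) - (t \<cdot>\<^sub>m map_mat f A + (1 - t) \<cdot>\<^sub>m map_mat f B)
      = t \<cdot>\<^sub>m map_mat (\<lambda>x. - f x) A + (1 - t) \<cdot>\<^sub>m map_mat (\<lambda>x. - f x) B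
        - map_mat (\<lambda>x. - f x) (t \<cdot>\<^sub>m A + (1 - t) \<cdot>\<^sub>m B)"
    if "A \<in> C" "B \<in> C" for A B t
  proof -
    have "A \<in> carrier_mat n n" "B \<in> carrier_mat n n"
      using that assms by auto
    then show ?thesis
      by (intro eq_matI) auto
  qed
  then show ?thesis
    unfolding loewner_concave_on_def loewner_convex_on_def loewner_le_def by simp
qed

lemma affine_fun_on_uminus: "affine_fun_on S (\<lambda>x. - f x) \<longleftrightarrow> affine_fun_on S f"
proof -
  have "affine_fun_on S (\<lambda>x. - g x)" if "affine_fun_on S g" for g
  proof -
    from that obtain a b where "\<forall>x\<in>S. g x = a * x + b"
      unfolding affine_fun_on_def by blast
    then have "\<forall>x\<in>S. - g x = (- a) * x + (- b)"
      by simp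
    then show ?thesis
      unfolding affine_fun_on_def by blast
  qed
  from this[of f] this[of "\<lambda>x. - f x"] show ?thesis
    by auto
qed

lemma loewner_convex_of_affine:
  assumes "C \<subseteq> carrier_mat n n"
    and nonneg: "\<And>A i j. A \<in> C \<Longrightarrow> i < n \<Longrightarrow> j < n \<Longrightarrow> 0 \<le> A $$ (i, j)"
    and "affine_fun_on {0..} f"
  shows "loewner_convex_on C f"
  unfolding loewner_convex_on_iff_gap[OF assms(1)]
proof (intro ballI allI impI)
  fix A B and t :: real
  assume AB: "A \<in> C" "B \<in> C" and t: "0 \<le> t \<and> t \<le> 1"
  obtain a b where f: "\<And>x. 0 \<le> x \<Longrightarrow> f x = a * x + b"
    using assms(3) unfolding affine_fun_on_def by auto
  have "jensen_gap f t (A $$ (i, j)) (B $$ (i, j)) = 0" if "i < n" "j < n" for i j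
  proof -
    have "0 \<le> A $$ (i, j)" "0 \<le> B $$ (i, j)"
      using nonneg AB that by auto
    moreover from this have "0 \<le> t * A $$ (i, j) + (1 - t) * B $$ (i, j)"
      using t by simp
    ultimately show ?thesis
      unfolding jensen_gap_def by (simp only: f) (simp add: algebra_simps)
  qed
  then have "mat n n (\<lambda>(i, j). jensen_gap f t (A $$ (i, j)) (B $$ (i, j))) = 0\<^sub>m n n"
    by (intro eq_matI) auto
  then show "pos_semidef (mat n n (\<lambda>(i, j). jensen_gap f t (A $$ (i, j)) (B $$ (i, j))))"
    by (auto simp: pos_semidef_def scalar_prod_def intro!: sum_nonneg)
qed

text \<open>Both inequalities are values of the quadratic form, at \<open>e\<^sub>i\<close> and at \<open>e\<^sub>i - e\<^sub>j\<close>.\<close>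

lemma pos_semidef_entries:
  assumes psd: "pos_semidef D" and D: "D \<in> carrier_mat n n" and "i < n" "j < n"
  shows "0 \<le> D $$ (i, i)"
    and "D $$ (i, j) + D $$ (j, i) \<le> D $$ (i, i) + D $$ (j, j)"
proof -
  have q: "0 \<le> v \<bullet> (D *\<^sub>v v)" if "v \<in> carrier_vec n" for v
    using psd D that by (auto simp: pos_semidef_def)
  have e: "unit_vec n k \<bullet> (D *\<^sub>v unit_vec n l) = D $$ (k, l)" if "k < n" "l < n" for k l
    using D that by (simp add: scalar_prod_left_unit scalar_prod_right_unit)
  show "0 \<le> D $$ (i, i)"
    using q[of "unit_vec n i"] e[of i i] assms by simp
  have "(unit_vec n i - unit_vec n j) \<bullet> (D *\<^sub>v (unit_vec n i - unit_vec n j))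
      = D $$ (i, i) - D $$ (i, j) - (D $$ (j, i) - D $$ (j, j))"
    using assms e D
    by (simp add: mult_minus_distrib_mat_vec[of _ n n] minus_scalar_prod_distrib[of _ n]
        scalar_prod_minus_distrib[of _ n])
  then show "D $$ (i, j) + D $$ (j, i) \<le> D $$ (i, i) + D $$ (j, j)"
    using q[of "unit_vec n i - unit_vec n j"] by simp
qed

lemma affine_of_gap_zero:
  assumes gap: "\<And>b t. 0 \<le> b \<Longrightarrow> 0 \<le> t \<Longrightarrow> t \<le> 1 \<Longrightarrow> jensen_gap f t 0 b = 0"
  shows "affine_fun_on {0..} f"
proof -
  have f: "f x = (f 1 - f 0) * x + f 0" if "0 \<le> x" for x
  proof (cases "x \<le> 1")
    case True
    then show ?thesis
      using gap[of 1 "1 - x"] that by (simp add: jensen_gap_def algebra_simps)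
  next
    case False
    \<comment> \<open>Here \<open>1\<close> lies between \<open>0\<close> and \<open>x\<close>, so affinity on \<open>[0, x]\<close> gives \<open>f 1\<close> in terms of \<open>f x\<close>.\<close>
    then have "(1 - 1 / x) * f 0 + f x / x = f 1"
      using gap[of x "1 - 1 / x"] by (simp add: jensen_gap_def)
    then have "x * ((1 - 1 / x) * f 0 + f x / x) = x * f 1"
      by (simp only:)
    moreover have "x * ((1 - 1 / x) * f 0 + f x / x) = (x - 1) * f 0 + f x"
      using False by (simp add: distrib_left right_diff_distrib left_diff_distrib)
    ultimately have "(x - 1) * f 0 + f x = x * f 1"
      by (simp only:)
    then show ?thesis
      by (simp add: algebra_simps)
  qed
  show ?thesis
    unfolding affine_fun_on_def Ball_def atLeast_iff using f by blast
qed

text \<open>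
  The shape of the witnesses is symmetric in the two indices: \<open>i = 0\<close>, \<open>j = 1\<close> fits the Min cone,
  and \<open>i = 1\<close>, \<open>j = 0\<close> the Max cone. The two matrices agree at \<open>(j, j)\<close>, which kills the gap
  there, while the other three entries carry the same gap \<open>g\<close>; then \<open>0 \<le> g\<close> and
  \<open>g + g \<le> g + 0\<close>.
\<close>

lemma affine_of_loewner_convex:
  assumes C: "C \<subseteq> carrier_mat n n" and conv: "loewner_convex_on C f"
    and ij: "i < n" "j < n"
    and wit: "\<And>b. 0 \<le> b \<Longrightarrow> \<exists>A\<in>C. \<exists>B\<in>C.
      A $$ (i, i) = 0 \<and> A $$ (i, j) = 0 \<and> A $$ (j, i) = 0 \<and> A $$ (j, j) = b \<and>
      B $$ (i, i) = b \<and> B $$ (i, j) = b \<and> B $$ (j, i) = b \<and> B $$ (j, j) = b"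
  shows "affine_fun_on {0..} f"
proof (rule affine_of_gap_zero)
  fix b t :: real
  assume b: "0 \<le> b" and t: "0 \<le> t" "t \<le> 1"
  obtain A B where AB: "A \<in> C" "B \<in> C"
    and A: "A $$ (i, i) = 0" "A $$ (i, j) = 0" "A $$ (j, i) = 0" "A $$ (j, j) = b"
    and B: "B $$ (i, i) = b" "B $$ (i, j) = b" "B $$ (j, i) = b" "B $$ (j, j) = b"
    using wit[OF b] by blast
  define D where "D = mat n n (\<lambda>(i, j). jensen_gap f t (A $$ (i, j)) (B $$ (i, j)))"
  have "pos_semidef D"
    using conv AB t unfolding loewner_convex_on_iff_gap[OF C] D_def by blast
  moreover have "D \<in> carrier_mat n n"
    by (simp add: D_def)
  moreover have "D $$ (j, j) = 0"
    using ij A B by (simp add: D_def jensen_gap_def algebra_simps)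
  moreover have "D $$ (i, i) = jensen_gap f t 0 b" "D $$ (i, j) = jensen_gap f t 0 b"
    "D $$ (j, i) = jensen_gap f t 0 b"
    using ij A B by (simp_all add: D_def)
  ultimately show "jensen_gap f t 0 b = 0"
    using pos_semidef_entries[of D n i j] ij by simp
qed

lemma C_min_carrier: "C_min n \<subseteq> carrier_mat n n"
  by (auto simp: C_min_def A_min_def)

lemma C_max_carrier: "C_max n \<subseteq> carrier_mat n n"
  by (auto simp: C_max_def A_max_def)

lemma C_min_nonneg: "A \<in> C_min n \<Longrightarrow> i < n \<Longrightarrow> j < n \<Longrightarrow> 0 \<le> A $$ (i, j)"
  by (auto simp: C_min_def A_min_def)

lemma C_max_nonneg: "A \<in> C_max n \<Longrightarrow> i < n \<Longrightarrow> j < n \<Longrightarrow> 0 \<le> A $$ (i, j)"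
  by (auto simp: C_max_def A_max_def)

lemma A_min_in_C_min_2:
  assumes "0 \<le> c" "c \<le> d"
  shows "A_min (vec 2 (\<lambda>k. if k = 0 then c else d)) \<in> C_min 2"
  unfolding C_min_def using assms
  by (intro CollectI exI[of _ "vec 2 (\<lambda>k. if k = 0 then c else d)"]) auto

lemma A_max_in_C_max_2:
  assumes "0 \<le> d" "d \<le> c"
  shows "A_max (vec 2 (\<lambda>k. if k = 0 then c else d)) \<in> C_max 2"
  unfolding C_max_def using assms
  by (intro CollectI exI[of _ "vec 2 (\<lambda>k. if k = 0 then c else d)"]) auto

lemma affine_of_convex_C_min_2:
  assumes "loewner_convex_on (C_min 2) f"
  shows "affine_fun_on {0..} f"
proof (rule affine_of_loewner_convex[OF C_min_carrier assms, of 0 1])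
  fix b :: real
  assume b: "0 \<le> b"
  let ?A = "A_min (vec 2 (\<lambda>k. if k = 0 then 0 else b))"
  let ?B = "A_min (vec 2 (\<lambda>k. if k = 0 then b else b))"
  have "?A \<in> C_min 2" "?B \<in> C_min 2"
    using b by (intro A_min_in_C_min_2; simp)+
  moreover have "?A $$ (0, 0) = 0 \<and> ?A $$ (0, 1) = 0 \<and> ?A $$ (1, 0) = 0 \<and> ?A $$ (1, 1) = b \<and>
      ?B $$ (0, 0) = b \<and> ?B $$ (0, 1) = b \<and> ?B $$ (1, 0) = b \<and> ?B $$ (1, 1) = b"
    by (simp add: A_min_def)
  ultimately show "\<exists>A\<in>C_min 2. \<exists>B\<in>C_min 2.
      A $$ (0, 0) = 0 \<and> A $$ (0, 1) = 0 \<and> A $$ (1, 0) = 0 \<and> A $$ (1, 1) = b \<and>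
      B $$ (0, 0) = b \<and> B $$ (0, 1) = b \<and> B $$ (1, 0) = b \<and> B $$ (1, 1) = b"
    by blast
qed simp_all

lemma affine_of_convex_C_max_2:
  assumes "loewner_convex_on (C_max 2) f"
  shows "affine_fun_on {0..} f"
proof (rule affine_of_loewner_convex[OF C_max_carrier assms, of 1 0])
  fix b :: real
  assume b: "0 \<le> b"
  let ?A = "A_max (vec 2 (\<lambda>k. if k = 0 then b else 0))"
  let ?B = "A_max (vec 2 (\<lambda>k. if k = 0 then b else b))"
  have "?A \<in> C_max 2" "?B \<in> C_max 2"
    using b by (intro A_max_in_C_max_2; simp)+
  moreover have "?A $$ (1, 1) = 0 \<and> ?A $$ (1, 0) = 0 \<and> ?A $$ (0, 1) = 0 \<and> ?A $$ (0, 0) = b \<and>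
      ?B $$ (1, 1) = b \<and> ?B $$ (1, 0) = b \<and> ?B $$ (0, 1) = b \<and> ?B $$ (0, 0) = b"
    by (simp add: A_max_def)
  ultimately show "\<exists>A\<in>C_max 2. \<exists>B\<in>C_max 2.
      A $$ (1, 1) = 0 \<and> A $$ (1, 0) = 0 \<and> A $$ (0, 1) = 0 \<and> A $$ (0, 0) = b \<and>
      B $$ (1, 1) = b \<and> B $$ (1, 0) = b \<and> B $$ (0, 1) = b \<and> B $$ (0, 0) = b"
    by blast
qed simp_all

text \<open>
  Families of nonnegative matrix sets, one for each size, whose member of size 2 detects affinity
  by convexity. Passing from size 2 to all sizes works the same way for all of them, because
  affinity lies between the two and is insensitive to the sign of the function.
\<close>

locale affinity_detecting_family =
  fixes C :: "nat \<Rightarrow> real mat set"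
  assumes carrier: "C n \<subseteq> carrier_mat n n"
    and nonneg: "A \<in> C n \<Longrightarrow> i < n \<Longrightarrow> j < n \<Longrightarrow> 0 \<le> A $$ (i, j)"
    and affine_of_convex_2: "loewner_convex_on (C 2) f \<Longrightarrow> affine_fun_on {0..} f"
begin

lemma convex_of_affine: "affine_fun_on {0..} f \<Longrightarrow> loewner_convex_on (C n) f"
  using loewner_convex_of_affine[OF carrier nonneg] .

lemma convex_2_iff_affine: "loewner_convex_on (C 2) f \<longleftrightarrow> affine_fun_on {0..} f"
  using affine_of_convex_2 convex_of_affine by blast

lemma convex_iff_affine: "(\<forall>n\<ge>1. loewner_convex_on (C n) f) \<longleftrightarrow> affine_fun_on {0..} f"
proof
  assume "\<forall>n\<ge>1. loewner_convex_on (C n) f"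
  then have "loewner_convex_on (C 2) f"
    by simp
  then show "affine_fun_on {0..} f"
    by (rule affine_of_convex_2)
qed (simp add: convex_of_affine)

lemma concave_2_iff_affine: "loewner_concave_on (C 2) f \<longleftrightarrow> affine_fun_on {0..} f"
  by (simp only: loewner_concave_on_iff_convex_uminus[OF carrier] convex_2_iff_affine
      affine_fun_on_uminus)

lemma concave_iff_affine: "(\<forall>n\<ge>1. loewner_concave_on (C n) f) \<longleftrightarrow> affine_fun_on {0..} f"
  by (simp only: loewner_concave_on_iff_convex_uminus[OF carrier] convex_iff_affine
      affine_fun_on_uminus)

end

theorem proposition5p4:
  fixes f :: "real \<Rightarrow> real"
  shows
    "((\<forall>n\<ge>1. loewner_convex_on (C_min n) f) \<longleftrightarrow> (\<forall>n\<ge>1. loewner_concave_on (C_min n) f)) \<and>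
     ((\<forall>n\<ge>1. loewner_concave_on (C_min n) f) \<longleftrightarrow> affine_fun_on {0..} f) \<and>
     (loewner_convex_on (C_min 2) f \<longleftrightarrow> (\<forall>n\<ge>1. loewner_convex_on (C_min n) f)) \<and>
     (loewner_concave_on (C_min 2) f \<longleftrightarrow> (\<forall>n\<ge>1. loewner_concave_on (C_min n) f)) \<and>
     ((\<forall>n\<ge>1. loewner_convex_on (C_max n) f) \<longleftrightarrow> (\<forall>n\<ge>1. loewner_concave_on (C_max n) f)) \<and>
     ((\<forall>n\<ge>1. loewner_concave_on (C_max n) f) \<longleftrightarrow> affine_fun_on {0..} f) \<and>
     (loewner_convex_on (C_max 2) f \<longleftrightarrow> (\<forall>n\<ge>1. loewner_convex_on (C_max n) f)) \<and>
     (loewner_concave_on (C_max 2) f \<longleftrightarrow> (\<forall>n\<ge>1. loewner_concave_on (C_max n) f))"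
proof -
  interpret Min: affinity_detecting_family C_min
    using C_min_carrier C_min_nonneg affine_of_convex_C_min_2 by unfold_locales
  interpret Max: affinity_detecting_family C_max
    using C_max_carrier C_max_nonneg affine_of_convex_C_max_2 by unfold_locales
  show ?thesis
    by (simp only: Min.convex_2_iff_affine Min.convex_iff_affine
        Min.concave_2_iff_affine Min.concave_iff_affine
        Max.convex_2_iff_affine Max.convex_iff_affine
        Max.concave_2_iff_affine Max.concave_iff_affine simp_thms)
qed

end
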